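(* Suppose that (i) for every $z\in Z_Q$, $\theta\mapsto Q_\theta(z)$ is twice continuously differentiable on $B_Q$ with gradients and Hessians bounded uniformly over $\theta\in B_Q$, $z\in Z_Q$ (and the analogous smoothness holds for the auxiliary functions $\zeta_\phi$, which do not enter the conclusion), and (ii) there exists $\mu_Q>0$ such that $J_Q(\theta;Z_Q)J_Q(\theta;Z_Q)^\top\succeq\mu_QI_M$ for every $\theta\in B_Q$. Then there exists a constant $c_{\rm NLL}>0$ such that $$\tfrac12\|\nabla_\theta\widehat L_{\rm NLL}(\theta)\|_2^2\ge c_{\rm NLL}\bigl(\widehat L_{\rm NLL}(\theta)-\widehat L_{\rm NLL}^*\bigr)\qquad\forall\theta\in B_Q,$$ where $\widehat L_{\rm NLL}^*=\inf_{\theta\in B_Q}\widehat L_{\rm NLL}(\theta)$.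
   Context: $\mathcal S$ is a (possibly continuous) state space, $\mathcal A$ a finite action set, $Q_\theta:\mathcal S\times\mathcal A\to\mathbb R$ ($\theta\in\mathbb R^{d_\theta}$) a parametrized function, $B_Q\subset\mathbb R^{d_\theta}$ a closed finite-radius ball. $\hat p_Q(a\mid s)=\exp(Q(s,a))/\sum_{b\in\mathcal A}\exp(Q(s,b))$. Grouped empirical negative log-likelihood (from a finite dataset): $\mathcal X_{\rm NLL}\subset\mathcal S$ is a finite set of distinct sampled states with empirical weights $\omega^{\rm NLL}_x>0$, $\sum_x\omega_x^{\rm NLL}=1$, and empirical action distributions $\widehat\pi_x$ on $\mathcal A$; $$\widehat L_{\rm NLL}(\theta)=\sum_{x\in\mathcal X_{\rm NLL}}\omega_x^{\rm NLL}\sum_{a\in\mathcal A}\widehat\pi_x(a)\bigl[-\log\hat p_{Q_\theta}(a\mid x)\bigr].$$ $\mathcal X_Q\supseteq\mathcal X_{\rm NLL}$ is the finite set of all sampled states at which the empirical objective evaluates $Q_\theta$, $Z_Q=\mathcal X_Q\times\mathcal A=\{z_1,\dots,z_M\}$, and $J_Q(\theta;Z_Q)=D_\theta(Q_\theta(z_1),\dots,Q_\theta(z_M))^\top\in\mathbb R^{M\times d_\theta}$. *)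

theory Defs
  imports "HOL-Analysis.Analysis" "HOL-Probability.Probability_Mass_Function"
begin

text \<open>
  Derivatives on a set \<open>B\<close> are taken relative to \<open>B\<close>, i.e. with respect to the filter
  \<open>at x within B\<close>. When \<open>B\<close> is a closed ball of positive radius, this derivative is unique at
  every point of \<open>B\<close>, boundary included, and it agrees with the ordinary derivative wherever the
  latter exists.
\<close>

definition jacobian_on :: "(real^'d) set \<Rightarrow> (real^'d \<Rightarrow> real^'m) \<Rightarrow> real^'d \<Rightarrow> real^'d^'m" where
  "jacobian_on B f x = matrix (frechet_derivative f (at x within B))"

definition grad_on :: "(real^'d) set \<Rightarrow> (real^'d \<Rightarrow> real) \<Rightarrow> real^'d \<Rightarrow> real^'d" where
  "grad_on B f x = (\<chi> i. frechet_derivative f (at x within B) (axis i 1))"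

definition hessian_on :: "(real^'d) set \<Rightarrow> (real^'d \<Rightarrow> real) \<Rightarrow> real^'d \<Rightarrow> real^'d^'d" where
  "hessian_on B f x = jacobian_on B (grad_on B f) x"

text \<open>Continuity of the gradient is implied by its differentiability.\<close>

definition C2_on :: "(real^'d) set \<Rightarrow> (real^'d \<Rightarrow> real) \<Rightarrow> bool" where
  "C2_on B f \<longleftrightarrow>
     f differentiable_on B \<and> grad_on B f differentiable_on B \<and> continuous_on B (hessian_on B f)"

definition uniformly_C2_on :: "(real^'d) set \<Rightarrow> 'z set \<Rightarrow> (real^'d \<Rightarrow> 'z \<Rightarrow> real) \<Rightarrow> bool" where
  "uniformly_C2_on B Z F \<longleftrightarrow>
     (\<forall>z\<in>Z. C2_on B (\<lambda>\<theta>. F \<theta> z)) \<and>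
     bounded {grad_on B (\<lambda>\<theta>. F \<theta> z) \<theta> | \<theta> z. \<theta> \<in> B \<and> z \<in> Z} \<and>
     bounded {hessian_on B (\<lambda>\<theta>. F \<theta> z) \<theta> | \<theta> z. \<theta> \<in> B \<and> z \<in> Z}"

definition psd :: "real^'m^'m \<Rightarrow> bool" where
  "psd A \<longleftrightarrow> transpose A = A \<and> (\<forall>v. 0 \<le> v \<bullet> (A *v v))"

definition loewner_ge :: "real^'m^'m \<Rightarrow> real^'m^'m \<Rightarrow> bool" where
  "loewner_ge A B \<longleftrightarrow> psd (A - B)"

definition softmax_policy :: "('s \<times> 'a::finite \<Rightarrow> real) \<Rightarrow> 's \<Rightarrow> 'a \<Rightarrow> real" where
  "softmax_policy q s a = exp (q (s, a)) / (\<Sum>b\<in>UNIV. exp (q (s, b)))"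

definition empirical_nll ::
  "'s set \<Rightarrow> ('s \<Rightarrow> real) \<Rightarrow> ('s \<Rightarrow> 'a::finite pmf) \<Rightarrow> ('p \<Rightarrow> 's \<times> 'a \<Rightarrow> real) \<Rightarrow> 'p \<Rightarrow> real" where
  "empirical_nll X \<omega> \<pi> Q \<theta> =
     (\<Sum>x\<in>X. \<omega> x * (\<Sum>a\<in>UNIV. pmf (\<pi> x) a * (- ln (softmax_policy (Q \<theta>) x a))))"

end

theory Submission
  imports Defs
begin

text \<open>
  The full-rank hypothesis on the Jacobian reduces the claim to the logits: the squared gradient
  norm is at least \<open>\<mu>\<^sub>Q\<close> times the squared norm of the logit gradient, whose
  entries are \<open>\<omega> x * (p a - \<pi> a)\<close>. By Gibbs' inequality the infimum of the
  loss is at least the average entropy of the empirical action distributions, so the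
  suboptimality is at most the average Kullback-Leibler divergence of \<open>\<pi>\<close> from
  \<open>p\<close>. That divergence is at most the chi-squared distance, hence at most
  \<open>\<Sum>a. (p a - \<pi> a)\<^sup>2\<close> divided by a lower bound on the softmax
  probabilities, which exists because the ball is compact.
\<close>

section \<open>Derivatives relative to a convex set with interior\<close>

text \<open>Every \<open>w\<close> is a multiple of a difference of two points of \<open>S\<close>,
  namely \<open>v + t *\<^sub>R w\<close> and \<open>v\<close> for a small
  \<open>t > 0\<close>.\<close>

lemma linear_eq_0_on_open:
  fixes h :: "'v::real_normed_vector \<Rightarrow> 'w::real_vector"
  assumes "linear h" "open S" "S \<noteq> {}" and z: "\<And>v. v \<in> S \<Longrightarrow> h v = 0"
  shows "h w = 0"
proof -
  obtain v where v: "v \<in> S" using assms by blast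
  obtain e where e: "e > 0" "ball v e \<subseteq> S"
    using \<open>open S\<close> v openE by blast
  \<comment> \<open>Adding \<open>1\<close> keeps the denominator positive when
    \<open>w = 0\<close>; the displacement then has norm at most \<open>e / 2\<close>.\<close>
  define t where "t = e / (2 * (norm w + 1))"
  have n: "norm w + 1 > 0" using norm_ge_zero[of w] by linarith
  have t: "t > 0" using e(1) n by (simp add: t_def)
  have "norm (t *\<^sub>R w) < e"
  proof -
    have "norm (t *\<^sub>R w) \<le> t * (norm w + 1)" using t by simp
    also have "\<dots> = e / 2" using n by (simp add: t_def field_simps)
    finally show ?thesis using e(1) by linarith
  qed
  then have "v + t *\<^sub>R w \<in> S" using e(2) by (auto simp: dist_norm)
  then have "h (v + t *\<^sub>R w) = 0" by (rule z)
  then have "t *\<^sub>R h w = 0" using z[OF v] assms(1) by (simp add: linear_add linear_scale)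
  then show ?thesis using t by simp
qed

text \<open>The difference \<open>h\<close> of the two derivatives is a derivative of the zero
  function. Restricted to the segment from \<open>x\<close> to any \<open>y\<close> in
  \<open>B\<close>, it must vanish on \<open>y - x\<close>. These directions contain the translate
  of the interior by \<open>- x\<close>, which is open and nonempty, so \<open>h\<close> is zero.
  This covers the boundary points of a closed ball, where only some directions point into the
  set.\<close>

lemma has_derivative_unique_within_convex:
  fixes f :: "'v::real_normed_vector \<Rightarrow> 'w::real_normed_vector"
  assumes f': "(f has_derivative f') (at x within B)"
    and f'': "(f has_derivative f'') (at x within B)"
    and B: "convex B" "interior B \<noteq> {}" "x \<in> B"
  shows "f' = f''"
proof
  fix w
  define h where "h v = f' v - f'' v" for v
  have lin: "linear h"
    unfolding h_def using f' f'' by (intro linear_compose_sub has_derivative_linear)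
  have 0: "((\<lambda>_. 0) has_derivative h) (at x within B)"
    using has_derivative_diff[OF f' f''] by (simp add: h_def[abs_def])
  have h0: "h (y - x) = 0" if "y \<in> B" for y
  proof -
    define l where "l t = x + t *\<^sub>R (y - x)" for t :: real
    have lB: "l ` {0..1} \<subseteq> B"
      using B that convexD_alt[of B x y] by (auto simp: l_def algebra_simps)
    have "(l has_derivative (\<lambda>t. t *\<^sub>R (y - x))) (at 0 within {0..1})"
      unfolding l_def by (auto intro!: derivative_eq_intros)
    moreover have "((\<lambda>_. 0) has_derivative h) (at (l 0) within l ` {0..1})"
      using has_derivative_subset[OF 0 lB] by (simp add: l_def)
    ultimately have "((\<lambda>_. 0) has_derivative (\<lambda>t. h (t *\<^sub>R (y - x)))) (at 0 within {0..1::real})"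
      using diff_chain_within[of l _ 0 "{0..1}" "\<lambda>_. 0" h] by (simp add: o_def)
    \<comment> \<open>A constant function on \<open>{0..1}\<close> also has vector derivative
      \<open>0\<close> at the endpoint \<open>0\<close>, and one-sided derivatives on an interval
      are unique.\<close>
    then have "((\<lambda>_. 0) has_vector_derivative h (y - x)) (at 0 within {0..1::real})"
      by (simp add: has_vector_derivative_def linear_scale[OF lin])
    then show ?thesis
      using vector_derivative_unique_within_closed_interval[of 0 "1::real" 0 "\<lambda>_. 0" "h (y - x)" 0]
      by simp
  qed
  have "h w = 0"
  proof (rule linear_eq_0_on_open[OF lin])
    show "open ((\<lambda>y. - x + y) ` interior B)" by (intro open_translation) simp
    show "(\<lambda>y. - x + y) ` interior B \<noteq> {}" using B by simp
    show "h v = 0" if "v \<in> (\<lambda>y. - x + y) ` interior B" for v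
      using that h0 interior_subset[of B] by auto
  qed
  then show "f' w = f'' w" by (simp add: h_def)
qed

text \<open>\<open>grad_on\<close> rests on the choice made by \<open>frechet_derivative\<close>;
  uniqueness allows it to be computed from any derivative that has been found.\<close>

lemma grad_on_eqI:
  assumes "(f has_derivative (\<lambda>h. g \<bullet> h)) (at x within B)"
    and "convex B" "interior B \<noteq> {}" "x \<in> B"
  shows "grad_on B f x = g"
proof -
  have "frechet_derivative f (at x within B) = (\<lambda>h. g \<bullet> h)"
    using assms by (intro has_derivative_unique_within_convex[OF _ assms(1)])
      (auto simp: differentiable_def frechet_derivative_works[symmetric])
  then show ?thesis by (simp add: grad_on_def vec_eq_iff inner_axis)
qed

section \<open>The full-rank condition as a norm bound\<close>

text \<open>The quadratic form of \<open>J ** transpose J\<close> at \<open>g\<close> is the squared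
  norm of \<open>transpose J *v g\<close>.\<close>

lemma norm_transpose_mult_ge:
  fixes J :: "real^'n^'m" and g :: "real^'m"
  assumes "loewner_ge (J ** transpose J) (\<mu> *\<^sub>R mat 1)"
  shows "(norm (transpose J *v g))\<^sup>2 \<ge> \<mu> * (norm g)\<^sup>2"
proof -
  have "0 \<le> g \<bullet> ((J ** transpose J - \<mu> *\<^sub>R mat 1) *v g)"
    using assms by (simp add: loewner_ge_def psd_def)
  also have "\<dots> = g \<bullet> (J *v (transpose J *v g)) - \<mu> * (g \<bullet> g)"
    by (simp add: matrix_vector_mult_diff_rdistrib matrix_vector_mul_assoc inner_diff_right
        scaleR_matrix_vector_assoc[symmetric] del: transpose_matrix_vector)
  also have "g \<bullet> (J *v (transpose J *v g)) = (transpose J *v g) \<bullet> (transpose J *v g)"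
    using dot_lmul_matrix[of g J "transpose J *v g"] by (simp only: transpose_matrix_vector)
  finally show ?thesis by (simp add: power2_norm_eq_inner)
qed

section \<open>Softmax probabilities and entropy inequalities\<close>

lemma softmax_policy_pos: "softmax_policy q s a > 0"
  unfolding softmax_policy_def by (intro divide_pos_pos sum_pos) auto

lemma sum_softmax_policy: "(\<Sum>a\<in>UNIV. softmax_policy q s a) = 1"
proof -
  have "(\<Sum>b\<in>UNIV. exp (q (s, b))) > 0" by (intro sum_pos) auto
  then show ?thesis by (simp add: softmax_policy_def flip: sum_divide_distrib)
qed

text \<open>Apply \<open>ln t \<le> t - 1\<close> at \<open>t = p a / r a\<close> in each term; the
  resulting bounds \<open>p a - r a\<close> sum to zero.\<close>

lemma gibbs_inequality:
  fixes p r :: "'a \<Rightarrow> real"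
  assumes "\<And>a. a \<in> A \<Longrightarrow> p a > 0" "\<And>a. a \<in> A \<Longrightarrow> r a \<ge> 0"
    and "(\<Sum>a\<in>A. p a) = (\<Sum>a\<in>A. r a)"
  shows "(\<Sum>a\<in>A. r a * (- ln (r a))) \<le> (\<Sum>a\<in>A. r a * (- ln (p a)))"
proof -
  have "r a * (- ln (r a)) - r a * (- ln (p a)) \<le> p a - r a" if a: "a \<in> A" for a
  proof (cases "r a = 0")
    case False
    then have r: "r a > 0" using assms(2)[OF a] by simp
    have "ln (p a / r a) \<le> p a / r a - 1"
      using r assms(1)[OF a] by (intro ln_le_minus_one) simp
    then have "r a * ln (p a / r a) \<le> r a * (p a / r a - 1)"
      using r by (intro mult_left_mono) auto
    then show ?thesis using r assms(1)[OF a] by (simp add: ln_div algebra_simps)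
  qed (use assms(1)[OF a] in simp)
  then have "(\<Sum>a\<in>A. r a * (- ln (r a)) - r a * (- ln (p a))) \<le> (\<Sum>a\<in>A. p a - r a)"
    by (intro sum_mono)
  then show ?thesis using assms(3) by (simp add: sum_subtractf sum_negf)
qed

text \<open>Here \<open>ln t \<le> t - 1\<close> is used at the reciprocal
  \<open>t = r a / p a\<close>, which bounds the divergence from above by the chi-squared
  distance.\<close>

lemma cross_entropy_minus_entropy_le:
  fixes p r :: "'a \<Rightarrow> real"
  assumes "\<delta> > 0" "\<And>a. a \<in> A \<Longrightarrow> p a \<ge> \<delta>" "\<And>a. a \<in> A \<Longrightarrow> r a \<ge> 0"
    and "(\<Sum>a\<in>A. p a) = (\<Sum>a\<in>A. r a)"
  shows "(\<Sum>a\<in>A. r a * (- ln (p a))) - (\<Sum>a\<in>A. r a * (- ln (r a)))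
    \<le> (\<Sum>a\<in>A. (p a - r a)\<^sup>2) / \<delta>"
proof -
  \<comment> \<open>The linear term \<open>r a - p a\<close> turns the bound into a perfect square
    over \<open>p a\<close> in each term, and it cancels on summation because the totals
    agree.\<close>
  have "r a * (- ln (p a)) - r a * (- ln (r a)) - (r a - p a) \<le> (p a - r a)\<^sup>2 / \<delta>"
    if a: "a \<in> A" for a
  proof -
    have p: "p a > 0" using assms(1,2) a by force
    have "r a * (- ln (p a)) - r a * (- ln (r a)) \<le> r a * (r a / p a - 1)"
    proof (cases "r a = 0")
      case False
      then have r: "r a > 0" using assms(3)[OF a] by simp
      have "ln (r a / p a) \<le> r a / p a - 1" using r p by (intro ln_le_minus_one) simp
      then have "r a * ln (r a / p a) \<le> r a * (r a / p a - 1)"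
        using r by (intro mult_left_mono) auto
      then show ?thesis using r p by (simp add: ln_div algebra_simps)
    qed simp
    also have "\<dots> = (p a - r a)\<^sup>2 / p a + (r a - p a)"
      using p by (simp add: field_simps power2_eq_square)
    also have "(p a - r a)\<^sup>2 / p a \<le> (p a - r a)\<^sup>2 / \<delta>"
      using assms(1) assms(2)[OF a] by (intro divide_left_mono) (auto simp: p)
    finally show ?thesis by simp
  qed
  then have "(\<Sum>a\<in>A. r a * (- ln (p a)) - r a * (- ln (r a)) - (r a - p a))
    \<le> (\<Sum>a\<in>A. (p a - r a)\<^sup>2 / \<delta>)"
    by (intro sum_mono)
  then show ?thesis using assms(4) by (simp add: sum_subtractf sum_negf sum_divide_distrib)
qed

text \<open>For each of the finitely many state-action pairs, a positive continuous function attains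
  its minimum on the compact set; the least of these minima serves all pairs.\<close>

lemma softmax_policy_bounded_below:
  fixes Q :: "'p::topological_space \<Rightarrow> 's \<times> 'a::finite \<Rightarrow> real"
  assumes "compact B" "finite X"
    and cont: "\<And>x a. x \<in> X \<Longrightarrow> continuous_on B (\<lambda>\<theta>. Q \<theta> (x, a))"
  obtains \<delta> where "\<delta> > 0" "\<And>\<theta> x a. \<theta> \<in> B \<Longrightarrow> x \<in> X \<Longrightarrow> softmax_policy (Q \<theta>) x a \<ge> \<delta>"
proof -
  have "\<exists>d>0. \<forall>\<theta>\<in>B. d \<le> softmax_policy (Q \<theta>) (fst y) (snd y)" if y: "y \<in> X \<times> UNIV" for y
  proof (cases "B = {}")
    case False
    have "continuous_on B (\<lambda>\<theta>. softmax_policy (Q \<theta>) (fst y) (snd y))"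
      unfolding softmax_policy_def
    proof (intro continuous_intros cont ballI)
      show "(\<Sum>b\<in>UNIV. exp (Q \<theta> (fst y, b))) \<noteq> 0" for \<theta>
        using sum_pos[of UNIV "\<lambda>b. exp (Q \<theta> (fst y, b))"] by auto
    qed (use y in auto)
    from continuous_attains_inf[OF \<open>compact B\<close> False this]
    obtain \<theta>' where "\<forall>\<theta>\<in>B. softmax_policy (Q \<theta>') (fst y) (snd y)
      \<le> softmax_policy (Q \<theta>) (fst y) (snd y)" by auto
    then show ?thesis
      by (intro exI[of _ "softmax_policy (Q \<theta>') (fst y) (snd y)"] conjI softmax_policy_pos)
  next
    case True
    then show ?thesis by (intro exI[of _ 1]) simp
  qed
  then have "\<forall>y\<in>X \<times> UNIV. \<exists>d>0. \<forall>\<theta>\<in>B. d \<le> softmax_policy (Q \<theta>) (fst y) (snd y)"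
    by blast
  then obtain d where "\<forall>y\<in>X \<times> UNIV. d y > 0 \<and> (\<forall>\<theta>\<in>B. d y \<le> softmax_policy (Q \<theta>) (fst y) (snd y))"
    by (rule bchoice[THEN exE])
  then have d: "\<And>y. y \<in> X \<times> UNIV \<Longrightarrow> d y > 0"
    "\<And>y \<theta>. y \<in> X \<times> UNIV \<Longrightarrow> \<theta> \<in> B \<Longrightarrow> d y \<le> softmax_policy (Q \<theta>) (fst y) (snd y)"
    by blast+
  \<comment> \<open>The extra element \<open>1\<close> keeps \<open>Min\<close> meaningful when
    \<open>X\<close> is empty, and it can only lower the bound.\<close>
  have fin: "finite (insert 1 (d ` (X \<times> (UNIV::'a set))))" using \<open>finite X\<close> by auto
  show ?thesis
  proof
    show "Min (insert 1 (d ` (X \<times> UNIV))) > 0" using fin d(1) by (subst Min_gr_iff) auto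
    show "Min (insert 1 (d ` (X \<times> UNIV))) \<le> softmax_policy (Q \<theta>) x a"
      if "\<theta> \<in> B" "x \<in> X" for \<theta> x a
      using Min_le[OF fin, of "d (x, a)"] d(2)[of "(x, a)" \<theta>] that by force
  qed
qed

section \<open>Derivative and suboptimality of the empirical loss\<close>

text \<open>Since each \<open>\<pi> x\<close> has total mass one, the loss at a state is log-sum-exp
  of the logits minus their mean under \<open>\<pi> x\<close>. The gradient of log-sum-exp is the
  softmax, which yields the coefficients \<open>softmax - pmf\<close>.\<close>

lemma empirical_nll_has_derivative:
  fixes Q :: "'p::real_normed_vector \<Rightarrow> 's \<times> 'a::finite \<Rightarrow> real"
  assumes D: "\<And>x a. x \<in> X \<Longrightarrow> ((\<lambda>\<theta>. Q \<theta> (x, a)) has_derivative D x a) (at \<theta> within B)"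
  shows "(empirical_nll X \<omega> \<pi> Q has_derivative
    (\<lambda>h. \<Sum>x\<in>X. \<omega> x * (\<Sum>a\<in>UNIV. (softmax_policy (Q \<theta>) x a - pmf (\<pi> x) a) * D x a h)))
    (at \<theta> within B)"
proof -
  define S where "S \<theta> x = (\<Sum>b\<in>UNIV. exp (Q \<theta> (x, b)))" for \<theta> x
  have S: "S \<theta> x > 0" for \<theta> x unfolding S_def by (intro sum_pos) auto
  have p1: "(\<Sum>a\<in>UNIV. pmf (\<pi> x) a) = 1" for x by (simp add: sum_pmf_eq_1)
  have nll: "empirical_nll X \<omega> \<pi> Q =
    (\<lambda>\<theta>. \<Sum>x\<in>X. \<omega> x * (ln (S \<theta> x) - (\<Sum>a\<in>UNIV. pmf (\<pi> x) a * Q \<theta> (x, a))))"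
  proof
    fix \<theta>
    have "(\<Sum>a\<in>UNIV. pmf (\<pi> x) a * (- ln (softmax_policy (Q \<theta>) x a)))
      = ln (S \<theta> x) - (\<Sum>a\<in>UNIV. pmf (\<pi> x) a * Q \<theta> (x, a))" for x
    proof -
      have "- ln (softmax_policy (Q \<theta>) x a) = ln (S \<theta> x) - Q \<theta> (x, a)" for a
        using S[of \<theta> x] by (simp add: softmax_policy_def ln_div S_def[symmetric])
      then show ?thesis
        by (simp add: right_diff_distrib sum_subtractf p1 flip: sum_distrib_right)
    qed
    then show "empirical_nll X \<omega> \<pi> Q \<theta> =
      (\<Sum>x\<in>X. \<omega> x * (ln (S \<theta> x) - (\<Sum>a\<in>UNIV. pmf (\<pi> x) a * Q \<theta> (x, a))))"
      by (simp add: empirical_nll_def)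
  qed
  have dS: "((\<lambda>\<theta>. S \<theta> x) has_derivative (\<lambda>h. \<Sum>b\<in>UNIV. exp (Q \<theta> (x, b)) * D x b h))
    (at \<theta> within B)" if "x \<in> X" for x
    unfolding S_def using D[OF that]
    by (auto intro!: derivative_eq_intros simp: mult.commute)
  have "((\<lambda>\<theta>. ln (S \<theta> x) - (\<Sum>a\<in>UNIV. pmf (\<pi> x) a * Q \<theta> (x, a))) has_derivative
    (\<lambda>h. \<Sum>a\<in>UNIV. (softmax_policy (Q \<theta>) x a - pmf (\<pi> x) a) * D x a h)) (at \<theta> within B)"
    if "x \<in> X" for x
  proof -
    have "((\<lambda>\<theta>. ln (S \<theta> x) - (\<Sum>a\<in>UNIV. pmf (\<pi> x) a * Q \<theta> (x, a))) has_derivative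
      (\<lambda>h. (\<Sum>b\<in>UNIV. exp (Q \<theta> (x, b)) * D x b h) * inverse (S \<theta> x)
        - (\<Sum>a\<in>UNIV. pmf (\<pi> x) a * D x a h))) (at \<theta> within B)"
      by (intro has_derivative_diff has_derivative_ln has_derivative_sum
          has_derivative_mult_right dS D S that)
    then show ?thesis
      by (simp add: softmax_policy_def S_def[symmetric] left_diff_distrib sum_subtractf
          sum_distrib_right divide_inverse mult.assoc mult.commute[of "inverse (S \<theta> x)"])
  qed
  then show ?thesis
    unfolding nll by (intro has_derivative_sum has_derivative_mult_right)
qed

text \<open>Gibbs' inequality at each state. The bound does not depend on \<open>\<theta>\<close>,
  so it passes to the infimum.\<close>

lemma entropy_le_empirical_nll:
  assumes "\<And>x. x \<in> X \<Longrightarrow> \<omega> x \<ge> 0"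
  shows "(\<Sum>x\<in>X. \<omega> x * (\<Sum>a\<in>UNIV. pmf (\<pi> x) a * (- ln (pmf (\<pi> x) a))))
    \<le> empirical_nll X \<omega> \<pi> Q \<theta>"
  unfolding empirical_nll_def using assms
  by (intro sum_mono mult_left_mono gibbs_inequality)
    (auto simp: softmax_policy_pos sum_softmax_policy sum_pmf_eq_1)

text \<open>The loss is linear in the weights while the squared logit gradient is quadratic in them;
  the lower bound \<open>m\<close> on the weights pays for the extra factor
  \<open>\<omega> x\<close>.\<close>

lemma empirical_nll_minus_entropy_le:
  assumes "m > 0" "\<And>x. x \<in> X \<Longrightarrow> m \<le> \<omega> x"
    and "\<delta> > 0" "\<And>x a. x \<in> X \<Longrightarrow> softmax_policy (Q \<theta>) x a \<ge> \<delta>"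
  shows "empirical_nll X \<omega> \<pi> Q \<theta>
      - (\<Sum>x\<in>X. \<omega> x * (\<Sum>a\<in>UNIV. pmf (\<pi> x) a * (- ln (pmf (\<pi> x) a))))
    \<le> (\<Sum>x\<in>X. \<Sum>a\<in>UNIV. (\<omega> x * (softmax_policy (Q \<theta>) x a - pmf (\<pi> x) a))\<^sup>2) / (m * \<delta>)"
proof -
  define d where "d x = (\<Sum>a\<in>UNIV. (softmax_policy (Q \<theta>) x a - pmf (\<pi> x) a)\<^sup>2)" for x
  have "\<omega> x * ((\<Sum>a\<in>UNIV. pmf (\<pi> x) a * (- ln (softmax_policy (Q \<theta>) x a)))
      - (\<Sum>a\<in>UNIV. pmf (\<pi> x) a * (- ln (pmf (\<pi> x) a)))) \<le> (\<omega> x)\<^sup>2 * d x / (m * \<delta>)"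
    if x: "x \<in> X" for x
  proof -
    have w: "\<omega> x > 0" using assms(1) assms(2)[OF x] by linarith
    have "(\<Sum>a\<in>UNIV. pmf (\<pi> x) a * (- ln (softmax_policy (Q \<theta>) x a)))
      - (\<Sum>a\<in>UNIV. pmf (\<pi> x) a * (- ln (pmf (\<pi> x) a))) \<le> d x / \<delta>"
      unfolding d_def using assms(3) assms(4)[OF x]
      by (intro cross_entropy_minus_entropy_le) (auto simp: sum_softmax_policy sum_pmf_eq_1)
    also have "d x / \<delta> \<le> (\<omega> x / m) * (d x / \<delta>)"
    proof -
      have "1 \<le> \<omega> x / m" using assms(1) assms(2)[OF x] by simp
      moreover have "0 \<le> d x / \<delta>" using assms(3) by (simp add: d_def sum_nonneg)
      ultimately show ?thesis using mult_right_mono[of 1 "\<omega> x / m" "d x / \<delta>"] by simp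
    qed
    finally have "\<omega> x * ((\<Sum>a\<in>UNIV. pmf (\<pi> x) a * (- ln (softmax_policy (Q \<theta>) x a)))
      - (\<Sum>a\<in>UNIV. pmf (\<pi> x) a * (- ln (pmf (\<pi> x) a)))) \<le> \<omega> x * (\<omega> x / m * (d x / \<delta>))"
      using w by (intro mult_left_mono) auto
    then show ?thesis by (simp add: power2_eq_square mult.assoc)
  qed
  then have "(\<Sum>x\<in>X. \<omega> x * ((\<Sum>a\<in>UNIV. pmf (\<pi> x) a * (- ln (softmax_policy (Q \<theta>) x a)))
      - (\<Sum>a\<in>UNIV. pmf (\<pi> x) a * (- ln (pmf (\<pi> x) a))))) \<le> (\<Sum>x\<in>X. (\<omega> x)\<^sup>2 * d x / (m * \<delta>))"
    by (intro sum_mono)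
  also have "\<dots> = (\<Sum>x\<in>X. \<Sum>a\<in>UNIV.
      (\<omega> x * (softmax_policy (Q \<theta>) x a - pmf (\<pi> x) a))\<^sup>2) / (m * \<delta>)"
    by (simp add: d_def power_mult_distrib flip: sum_distrib_left sum_divide_distrib)
  finally show ?thesis
    by (simp add: empirical_nll_def right_diff_distrib[of "\<omega> _"] sum_subtractf)
qed

section \<open>From the logit gradient to the parameter gradient on the ball\<close>

theorem lemma9:
  fixes Q :: "real^'d \<Rightarrow> 's \<times> 'a::finite \<Rightarrow> real"
    and \<zeta> :: "real^'k \<Rightarrow> 'z \<Rightarrow> real"
    and \<theta>\<^sub>0 :: "real^'d" and \<phi>\<^sub>0 :: "real^'k"
    and R\<^sub>Q R\<^sub>\<zeta> \<mu>\<^sub>Q :: real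
    and B\<^sub>Q :: "(real^'d) set" and B\<^sub>\<zeta> :: "(real^'k) set"
    and X\<^sub>N X\<^sub>Q :: "'s set"
    and Z\<^sub>Q :: "('s \<times> 'a) set" and Z\<^sub>\<zeta> :: "'z set"
    and \<omega> :: "'s \<Rightarrow> real"
    and \<pi> :: "'s \<Rightarrow> 'a pmf"
    and z :: "'m::finite \<Rightarrow> 's \<times> 'a"
  defines "B\<^sub>Q \<equiv> cball \<theta>\<^sub>0 R\<^sub>Q" and "B\<^sub>\<zeta> \<equiv> cball \<phi>\<^sub>0 R\<^sub>\<zeta>" and "Z\<^sub>Q \<equiv> X\<^sub>Q \<times> UNIV"
  assumes "R\<^sub>Q > 0" and "R\<^sub>\<zeta> > 0"
    and "finite X\<^sub>Q" and "X\<^sub>N \<subseteq> X\<^sub>Q" and "finite Z\<^sub>\<zeta>"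
    and "\<forall>x\<in>X\<^sub>N. \<omega> x > 0" and "(\<Sum>x\<in>X\<^sub>N. \<omega> x) = 1"
    and "bij_betw z UNIV Z\<^sub>Q"
    and "uniformly_C2_on B\<^sub>Q Z\<^sub>Q Q" and "uniformly_C2_on B\<^sub>\<zeta> Z\<^sub>\<zeta> \<zeta>"
    and "\<mu>\<^sub>Q > 0"
    and "\<forall>\<theta>\<in>B\<^sub>Q. let J = jacobian_on B\<^sub>Q (\<lambda>\<theta>. \<chi> i. Q \<theta> (z i)) \<theta>
                 in loewner_ge (J ** transpose J) (\<mu>\<^sub>Q *\<^sub>R mat 1)"
  shows "\<exists>c>0. \<forall>\<theta>\<in>B\<^sub>Q.
           1 / 2 * (norm (grad_on B\<^sub>Q (empirical_nll X\<^sub>N \<omega> \<pi> Q) \<theta>))\<^sup>2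
             \<ge> c * (empirical_nll X\<^sub>N \<omega> \<pi> Q \<theta> - (INF \<theta>'\<in>B\<^sub>Q. empirical_nll X\<^sub>N \<omega> \<pi> Q \<theta>'))"
proof -
  define L where "L = empirical_nll X\<^sub>N \<omega> \<pi> Q"
  define p where "p \<theta> x a = softmax_policy (Q \<theta>) x a" for \<theta> x a
  \<comment> \<open>\<open>H\<close> is the mean entropy, a lower bound for the loss;
    \<open>G \<theta>\<close> will be the squared norm of the gradient in the logits.\<close>
  define H where "H = (\<Sum>x\<in>X\<^sub>N. \<omega> x * (\<Sum>a\<in>UNIV. pmf (\<pi> x) a * (- ln (pmf (\<pi> x) a))))"
  define G where "G \<theta> = (\<Sum>x\<in>X\<^sub>N. \<Sum>a\<in>UNIV. (\<omega> x * (p \<theta> x a - pmf (\<pi> x) a))\<^sup>2)" for \<theta>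
  have finN: "finite X\<^sub>N" using assms by (meson finite_subset)
  have NQ: "x \<in> X\<^sub>Q" if "x \<in> X\<^sub>N" for x using that \<open>X\<^sub>N \<subseteq> X\<^sub>Q\<close> by blast
  have diffQ: "(\<lambda>\<theta>. Q \<theta> y) differentiable_on B\<^sub>Q" if "y \<in> Z\<^sub>Q" for y
    using \<open>uniformly_C2_on B\<^sub>Q Z\<^sub>Q Q\<close> that by (auto simp: uniformly_C2_on_def C2_on_def)
  obtain \<delta> where \<delta>: "\<delta> > 0" "\<And>\<theta> x a. \<theta> \<in> B\<^sub>Q \<Longrightarrow> x \<in> X\<^sub>N \<Longrightarrow> softmax_policy (Q \<theta>) x a \<ge> \<delta>"
  proof (rule softmax_policy_bounded_below[of B\<^sub>Q X\<^sub>N Q])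
    show "continuous_on B\<^sub>Q (\<lambda>\<theta>. Q \<theta> (x, a))" if "x \<in> X\<^sub>N" for x a
      by (rule differentiable_imp_continuous_on[OF diffQ]) (simp add: Z\<^sub>Q_def NQ that)
  qed (auto simp: B\<^sub>Q_def finN)
  define m where "m = Min (\<omega> ` X\<^sub>N)"
  have "X\<^sub>N \<noteq> {}" using \<open>(\<Sum>x\<in>X\<^sub>N. \<omega> x) = 1\<close> by auto
  then have m: "m > 0" "\<And>x. x \<in> X\<^sub>N \<Longrightarrow> m \<le> \<omega> x"
    using finN \<open>\<forall>x\<in>X\<^sub>N. \<omega> x > 0\<close> by (auto simp: m_def)
  have inf: "H \<le> (INF \<theta>'\<in>B\<^sub>Q. L \<theta>')"
  proof (rule cINF_greatest)
    show "B\<^sub>Q \<noteq> {}" using \<open>R\<^sub>Q > 0\<close> by (simp add: B\<^sub>Q_def)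
    show "H \<le> L \<theta>" for \<theta>
      unfolding H_def L_def using \<open>\<forall>x\<in>X\<^sub>N. \<omega> x > 0\<close>
      by (intro entropy_le_empirical_nll) (simp add: less_imp_le)
  qed
  have gap: "L \<theta> - H \<le> G \<theta> / (m * \<delta>)" if "\<theta> \<in> B\<^sub>Q" for \<theta>
    unfolding L_def H_def G_def p_def using m \<delta>(1) \<delta>(2)[OF that]
    by (rule empirical_nll_minus_entropy_le)
  have grad: "\<mu>\<^sub>Q * G \<theta> \<le> (norm (grad_on B\<^sub>Q L \<theta>))\<^sup>2" if \<theta>: "\<theta> \<in> B\<^sub>Q" for \<theta>
  proof -
    define F where "F \<theta> = (\<chi> i. Q \<theta> (z i))" for \<theta>
    define J where "J = jacobian_on B\<^sub>Q F \<theta>"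
    \<comment> \<open>The rows of \<open>J\<close> range over all of \<open>Z\<^sub>Q\<close>, but
      the loss involves only states in \<open>X\<^sub>N\<close>. The logit gradient is therefore
      extended by zero, and \<open>g\<close> lists it in the order of the enumeration
      \<open>z\<close>.\<close>
    define w where "w y = (if fst y \<in> X\<^sub>N
      then \<omega> (fst y) * (p \<theta> (fst y) (snd y) - pmf (\<pi> (fst y)) (snd y)) else 0)" for y
    define g :: "real^'m" where "g = (\<chi> i. w (z i))"
    have zZ: "z i \<in> Z\<^sub>Q" for i using \<open>bij_betw z UNIV Z\<^sub>Q\<close> by (auto simp: bij_betw_def)
    have sumZ: "(\<Sum>i\<in>UNIV. k (z i)) = (\<Sum>x\<in>X\<^sub>N. \<Sum>a\<in>UNIV. k (x, a))"
      if "\<And>x a. x \<notin> X\<^sub>N \<Longrightarrow> k (x, a) = 0" for k :: "'s \<times> 'a \<Rightarrow> real"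
    proof -
      have "(\<Sum>i\<in>UNIV. k (z i)) = (\<Sum>y\<in>Z\<^sub>Q. k y)"
        by (rule sum.reindex_bij_betw[OF \<open>bij_betw z UNIV Z\<^sub>Q\<close>])
      also have "\<dots> = (\<Sum>x\<in>X\<^sub>Q. \<Sum>a\<in>UNIV. k (x, a))"
        by (simp add: Z\<^sub>Q_def sum.cartesian_product)
      also have "\<dots> = (\<Sum>x\<in>X\<^sub>N. \<Sum>a\<in>UNIV. k (x, a))"
        by (rule sum.mono_neutral_right) (use assms that in auto)
      finally show ?thesis .
    qed
    have "\<exists>D. ((\<lambda>\<theta>. Q \<theta> (z i)) has_derivative D) (at \<theta> within B\<^sub>Q)" for i
      using diffQ[OF zZ] \<theta> by (auto simp: differentiable_on_def differentiable_def)
    then obtain D where "\<And>i. ((\<lambda>\<theta>. Q \<theta> (z i)) has_derivative D i) (at \<theta> within B\<^sub>Q)"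
      by metis
    then have "(F has_derivative (\<lambda>h. \<chi> i. D i h)) (at \<theta> within B\<^sub>Q)"
      by (subst has_derivative_componentwise_within) (auto simp: Basis_vec_def F_def inner_axis)
    then have F: "(F has_derivative (*v) J) (at \<theta> within B\<^sub>Q)"
      using jacobian_works by (auto simp: J_def jacobian_on_def jacobian_def differentiable_def)
    have DQ: "((\<lambda>\<theta>. Q \<theta> (z i)) has_derivative (\<lambda>h. (J *v h) $ i)) (at \<theta> within B\<^sub>Q)" for i
      using bounded_linear.has_derivative[OF bounded_linear_vec_nth F, of i]
      by (simp add: F_def)
    \<comment> \<open>The inverse enumeration picks out the row of \<open>J\<close> that belongs to
      a given state-action pair.\<close>
    define zi where "zi = inv_into UNIV z"
    have zi: "z (zi y) = y" if "y \<in> Z\<^sub>Q" for y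
      using \<open>bij_betw z UNIV Z\<^sub>Q\<close> that by (simp add: zi_def bij_betw_inv_into_right)
    have iz: "zi (z i) = i" for i
      using \<open>bij_betw z UNIV Z\<^sub>Q\<close> by (simp add: zi_def bij_betw_def)
    have "((\<lambda>\<theta>. Q \<theta> (x, a)) has_derivative (\<lambda>h. (J *v h) $ zi (x, a))) (at \<theta> within B\<^sub>Q)"
      if "x \<in> X\<^sub>N" for x a
      using DQ[of "zi (x, a)"] zi[of "(x, a)"] NQ[OF that] by (simp add: Z\<^sub>Q_def)
    from empirical_nll_has_derivative[where D = "\<lambda>x a h. (J *v h) $ zi (x, a)", OF this]
    have "(L has_derivative (\<lambda>h. \<Sum>x\<in>X\<^sub>N. \<omega> x *
        (\<Sum>a\<in>UNIV. (p \<theta> x a - pmf (\<pi> x) a) * (J *v h) $ zi (x, a)))) (at \<theta> within B\<^sub>Q)"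
      by (simp add: L_def p_def)
    \<comment> \<open>The chain rule in matrix form: the derivative is the pairing of
      \<open>g\<close> with \<open>J *v h\<close>, and moving \<open>J\<close> to the other side
      exhibits the gradient as \<open>transpose J *v g\<close>.\<close>
    also have "(\<lambda>h. \<Sum>x\<in>X\<^sub>N. \<omega> x *
        (\<Sum>a\<in>UNIV. (p \<theta> x a - pmf (\<pi> x) a) * (J *v h) $ zi (x, a)))
      = (\<lambda>h. (transpose J *v g) \<bullet> h)"
    proof
      fix h
      have "(transpose J *v g) \<bullet> h = g \<bullet> (J *v h)"
        by (simp add: dot_lmul_matrix)
      also have "\<dots> = (\<Sum>i\<in>UNIV. w (z i) * (J *v h) $ zi (z i))"
        by (simp add: inner_vec_def g_def iz)
      also have "\<dots> = (\<Sum>x\<in>X\<^sub>N. \<Sum>a\<in>UNIV. w (x, a) * (J *v h) $ zi (x, a))"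
        by (rule sumZ) (simp add: w_def)
      also have "\<dots> = (\<Sum>x\<in>X\<^sub>N. \<omega> x *
        (\<Sum>a\<in>UNIV. (p \<theta> x a - pmf (\<pi> x) a) * (J *v h) $ zi (x, a)))"
        by (simp add: w_def sum_distrib_left mult.assoc)
      finally show "(\<Sum>x\<in>X\<^sub>N. \<omega> x *
        (\<Sum>a\<in>UNIV. (p \<theta> x a - pmf (\<pi> x) a) * (J *v h) $ zi (x, a))) = (transpose J *v g) \<bullet> h"
        by simp
    qed
    finally have "grad_on B\<^sub>Q L \<theta> = transpose J *v g"
      using \<open>R\<^sub>Q > 0\<close> \<theta> by (intro grad_on_eqI) (auto simp: B\<^sub>Q_def)
    moreover have "(norm g)\<^sup>2 = G \<theta>"
    proof -
      have "(norm g)\<^sup>2 = (\<Sum>i\<in>UNIV. (w (z i))\<^sup>2)"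
        by (simp only: power2_norm_eq_inner) (simp add: inner_vec_def g_def power2_eq_square)
      also have "\<dots> = (\<Sum>x\<in>X\<^sub>N. \<Sum>a\<in>UNIV. (w (x, a))\<^sup>2)"
        by (rule sumZ) (simp add: w_def)
      also have "\<dots> = G \<theta>" by (simp add: G_def w_def)
      finally show ?thesis .
    qed
    moreover have "loewner_ge (J ** transpose J) (\<mu>\<^sub>Q *\<^sub>R mat 1)"
      using assms(15) \<theta> by (simp add: J_def F_def[abs_def] Let_def)
    ultimately show ?thesis using norm_transpose_mult_ge by metis
  qed
  \<comment> \<open>In the constant, \<open>m * \<delta>\<close> cancels the denominator in
    \<open>gap\<close>, \<open>\<mu>\<^sub>Q\<close> comes from \<open>grad\<close>, and
    \<open>1 / 2\<close> from the left side of the claim. Replacing the infimum by the smaller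
    \<open>H\<close> only enlarges the suboptimality.\<close>
  have "\<mu>\<^sub>Q * m * \<delta> / 2 * (L \<theta> - (INF \<theta>'\<in>B\<^sub>Q. L \<theta>')) \<le> 1 / 2 * (norm (grad_on B\<^sub>Q L \<theta>))\<^sup>2"
    if \<theta>: "\<theta> \<in> B\<^sub>Q" for \<theta>
  proof -
    have "\<mu>\<^sub>Q * m * \<delta> / 2 * (L \<theta> - (INF \<theta>'\<in>B\<^sub>Q. L \<theta>')) \<le> \<mu>\<^sub>Q * m * \<delta> / 2 * (G \<theta> / (m * \<delta>))"
      using inf gap[OF \<theta>] \<open>\<mu>\<^sub>Q > 0\<close> m(1) \<delta>(1) by (intro mult_left_mono) auto
    also have "\<dots> = 1 / 2 * (\<mu>\<^sub>Q * G \<theta>)" using m(1) \<delta>(1) by simp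
    also have "\<dots> \<le> 1 / 2 * (norm (grad_on B\<^sub>Q L \<theta>))\<^sup>2" using grad[OF \<theta>] by simp
    finally show ?thesis .
  qed
  moreover have "\<mu>\<^sub>Q * m * \<delta> / 2 > 0" using \<open>\<mu>\<^sub>Q > 0\<close> m(1) \<delta>(1) by simp
  ultimately show ?thesis unfolding L_def by blast
qed

end
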